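(* Let $m,n,k\ge 1$ be integers, let $B\in\mathbb{R}^{m\times n}$ be upper bidiagonal, let $b\in\mathbb{R}^m$, $c\in\mathbb{R}^n$, and let $A = B + b c^{T}$. Let $y_1,\dots,y_k\in\mathbb{R}^m$ and $w_2,\dots,w_{k+1}\in\mathbb{R}^n$ be vectors of Euclidean norm $1$, with associated left Householder reflectors $H^{\mathrm{l}}_i = I - 2y_i y_i^{T}\in\mathbb{R}^{m\times m}$ ($1\le i\le k$) and right Householder reflectors $H^{\mathrm{r}}_i = I - 2 w_i w_i^{T}\in\mathbb{R}^{n\times n}$ ($2\le i\le k+1$). Put $Y_k = [\,y_1\ y_2\ \cdots\ y_k\,]\in\mathbb{R}^{m\times k}$, $W_k=[\,w_2\ w_3\ \cdots\ w_{k+1}\,]\in\mathbb{R}^{n\times k}$, $Q_k = H^{\mathrm{l}}_1H^{\mathrm{l}}_2\cdots H^{\mathrm{l}}_k$ and $P_k = H^{\mathrm{r}}_2H^{\mathrm{r}}_3\cdots H^{\mathrm{r}}_{k+1}$. Let $T_k,R_k\in\mathbb{R}^{k\times k}$ be the upper triangular matrices $$(T_k)_{ij}=\begin{cases}2y_i^{T}y_j & i<j\\ 1 & i=j\\ 0&\text{otherwise,}\end{cases}\qquad (R_k)_{ij}=\begin{cases}2w_{i+1}^{T}w_{j+1} & i<j\\ 1 & i=j\\ 0&\text{otherwise.}\end{cases}$$ Then the matrix $A_{kk} := H^{\mathrm{l}}_k\cdots H^{\mathrm{l}}_1\, A\, H^{\mathrm{r}}_2\cdots H^{\mathrm{r}}_{k+1}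 = Q_k^{T} A P_k$ satisfies $$A_{kk} = B - \begin{bmatrix} b & Y_k & BW_k\end{bmatrix}\begin{bmatrix} -1 & 0_{1\times k} & c^{T}W_k\\ Y_k^{T}b & \tfrac12 T_k^{T} & Y_k^{T}BW_k\\ 0_{k\times 1} & 0_{k\times k} & \tfrac12 R_k\end{bmatrix}^{-1}\begin{bmatrix} c^{T}\\ Y_k^{T}B\\ W_k^{T}\end{bmatrix}.$$
   Context: All matrices are real, $I$ denotes the identity matrix of the appropriate size, and $0_{p\times q}$ is the $p\times q$ zero matrix. A matrix $B\in\mathbb{R}^{m\times n}$ is upper bidiagonal if its only possibly nonzero entries are on the diagonal and the first superdiagonal. A Householder reflector with essential vector $y\neq 0$ is $H=I-\tau y y^{T}$ with $\tau = 2/\|y\|_2^2$; for a unit vector $y$ this is $I-2yy^{T}$. The inverted middle matrix is a square matrix of size $(1+2k)\times(1+2k)$. *)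

theory Defs
  imports
    "Jordan_Normal_Form.Gauss_Jordan_Elimination"
    "HOL-Analysis.L2_Norm"
begin

definition upper_bidiagonal :: "'a::zero mat \<Rightarrow> bool" where
  "upper_bidiagonal B \<longleftrightarrow>
     (\<forall>i<dim_row B. \<forall>j<dim_col B. B $$ (i,j) \<noteq> 0 \<longrightarrow> j = i \<or> j = Suc i)"

definition vec_norm2 :: "real vec \<Rightarrow> real" where
  "vec_norm2 v = L2_set (\<lambda>i. v $ i) {0..<dim_vec v}"

text \<open>A vector as a one-column matrix; the corresponding row is
  \<^const>\<open>mat_of_row\<close>.\<close>

definition mat_of_col :: "'a vec \<Rightarrow> 'a mat" where
  "mat_of_col v = mat_of_cols (dim_vec v) [v]"

definition outer_prod :: "'a::semiring_0 vec \<Rightarrow> 'a vec \<Rightarrow> 'a mat" where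
  "outer_prod v w = mat_of_col v * mat_of_row w"

definition householder :: "real vec \<Rightarrow> real mat" where
  "householder y =
     1\<^sub>m (dim_vec y) - (2 / (vec_norm2 y)\<^sup>2) \<cdot>\<^sub>m outer_prod y y"

lemma householder_unit:
  "vec_norm2 y = 1 \<Longrightarrow> householder y = 1\<^sub>m (dim_vec y) - 2 \<cdot>\<^sub>m outer_prod y y"
  by (simp add: householder_def)

text \<open>The ordered product of a list of \<open>n \<times> n\<close> matrices; the size is needed
  for the empty list.\<close>

definition mat_prod_list :: "nat \<Rightarrow> 'a::semiring_1 mat list \<Rightarrow> 'a mat" where
  "mat_prod_list n Ms = foldr (*) Ms (1\<^sub>m n)"

definition reflector_triangle :: "real vec list \<Rightarrow> real mat" where
  "reflector_triangle vs = mat (length vs) (length vs)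
     (\<lambda>(i,j). if i < j then 2 * (vs ! i \<bullet> vs ! j) else if i = j then 1 else 0)"

text \<open>Horizontal juxtaposition, the counterpart of \<^const>\<open>append_rows\<close>.\<close>

definition append_cols :: "'a::zero mat \<Rightarrow> 'a mat \<Rightarrow> 'a mat" (infixr \<open>@\<^sub>c\<close> 66) where
  "A @\<^sub>c B = four_block_mat A B (0\<^sub>m 0 (dim_col A)) (0\<^sub>m 0 (dim_col B))"

text \<open>\<^const>\<open>mat_inverse\<close> returns an option; \<open>mat_inv M\<close> is meaningful only for
  invertible \<open>M\<close>, where it is the two-sided inverse.\<close>

definition mat_inv :: "'a::field mat \<Rightarrow> 'a mat" where
  "mat_inv M = the (mat_inverse M)"

lemma mat_inv_inverse:
  assumes M: "M \<in> carrier_mat n n" and inv: "invertible_mat M"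
  shows "mat_inv M \<in> carrier_mat n n" "M * mat_inv M = 1\<^sub>m n" "mat_inv M * M = 1\<^sub>m n"
proof -
  from inv obtain N where N: "inverts_mat M N" "inverts_mat N M"
    unfolding invertible_mat_def by blast
  have MN: "M * N = 1\<^sub>m n" and NM: "N * M = 1\<^sub>m (dim_row N)"
    using N M by (auto simp: inverts_mat_def)
  have "dim_col (M * N) = dim_col (1\<^sub>m n :: 'a mat)" by (simp only: MN)
  moreover have "dim_col (N * M) = dim_col (1\<^sub>m (dim_row N) :: 'a mat)" by (simp only: NM)
  ultimately have N': "N \<in> carrier_mat n n" using M by auto
  have "M \<in> Units (ring_mat TYPE('a) n ())"
    using M N' MN NM by (auto simp: Units_def ring_mat_def)
  then obtain K where K: "mat_inverse M = Some K"
    using mat_inverse(1)[OF M, where b = "()"] by (cases "mat_inverse M") auto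
  show "mat_inv M \<in> carrier_mat n n" "M * mat_inv M = 1\<^sub>m n" "mat_inv M * M = 1\<^sub>m n"
    using mat_inverse(2)[OF M K] K by (auto simp: mat_inv_def)
qed

end

theory Submission
  imports Defs "Jordan_Normal_Form.Determinant"
begin

text \<open>
  A product of reflectors is a perturbation of the identity of rank at most \<open>k\<close>. In compact
  form, \<open>H\<^sub>1 \<cdots> H\<^sub>k = I - Y S Y\<^sup>T\<close>, where \<open>S\<close> is upper triangular; the useful point is that
  \<open>S\<close> itself has complicated entries while its inverse does not: it is \<open>1/2\<close> times the unit upper
  triangular matrix whose entries above the diagonal are \<open>2 y\<^sub>i\<^sup>T y\<^sub>j\<close>
  (lemma \<open>householder_prod_compact\<close>). Thus
  \<open>Q\<^sup>T = I - Y L\<inverse> Y\<^sup>T\<close> and \<open>P = I - W U\<inverse> W\<^sup>T\<close> with \<open>L = T\<^sup>T/2\<close> and \<open>U = R/2\<close>.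

  Inserting both forms into \<open>Q\<^sup>T (B + b c\<^sup>T) P\<close> and multiplying out gives \<open>B\<close> plus terms which each
  have a left factor \<open>b\<close>, \<open>Y\<close> or \<open>B W\<close> and a right factor \<open>c\<^sup>T\<close>, \<open>Y\<^sup>T B\<close> or \<open>W\<^sup>T\<close>. Collecting
  the nine coefficients in a block matrix gives \<open>B - [b Y BW] N [c\<^sup>T; Y\<^sup>T B; W\<^sup>T]\<close>
  (lemma \<open>compact_two_sided_update\<close>). It remains to recognise \<open>N\<close> as the inverse of the middle
  matrix. Eliminating the blocks of the latter from the bottom row upwards shows this: the last block row
  involves only \<open>U\<close>, then the first is solved through its entry \<open>-1\<close>, then the middle one with
  \<open>L\<close> (lemma \<open>bordered_block_mult_inverse\<close>).
\<close>

section \<open>Block calculus\<close>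

lemma dim_append_cols [simp]:
  "dim_row (A @\<^sub>c B) = dim_row A" "dim_col (A @\<^sub>c B) = dim_col A + dim_col B"
  by (simp_all add: append_cols_def)

lemma dim_append_rows [simp]:
  "dim_row (A @\<^sub>r B) = dim_row A + dim_row B" "dim_col (A @\<^sub>r B) = dim_col A"
  by (simp_all add: append_rows_def)

lemma dim_mat_of_col [simp]: "dim_row (mat_of_col v) = dim_vec v" "dim_col (mat_of_col v) = 1"
  by (simp_all add: mat_of_col_def)

lemma index_append_cols:
  assumes "dim_row B = dim_row A" "i < dim_row A" "j < dim_col A + dim_col B"
  shows "(A @\<^sub>c B) $$ (i,j) = (if j < dim_col A then A $$ (i,j) else B $$ (i, j - dim_col A))"
  using assms by (simp add: append_cols_def)

lemma index_append_rows:
  assumes "dim_col B = dim_col A" "i < dim_row A + dim_row B" "j < dim_col A"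
  shows "(A @\<^sub>r B) $$ (i,j) = (if i < dim_row A then A $$ (i,j) else B $$ (i - dim_row A, j))"
  using assms by (simp add: append_rows_def)

text \<open>As rewrite rules, the next three lemmas multiply nested rows and columns of blocks: the
  first two pull a partition of the outer index out of a product, the third removes a
  partition of the summation index that both factors share.\<close>

lemma mult_append_cols:
  fixes A :: "'a::semiring_0 mat"
  assumes "dim_row B = dim_col A" "dim_row C = dim_col A"
  shows "A * (B @\<^sub>c C) = A * B @\<^sub>c A * C"
  using assms
  by (intro eq_matI) (auto simp: index_append_cols scalar_prod_def intro!: sum.cong)

lemma append_rows_mult:
  fixes C :: "'a::semiring_0 mat"
  assumes "dim_col A = dim_row C" "dim_col B = dim_row C"
  shows "(A @\<^sub>r B) * C = A * C @\<^sub>r B * C"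
  using assms
  by (intro eq_matI) (auto simp: index_append_rows scalar_prod_def intro!: sum.cong)

lemma append_cols_mult_append_rows:
  fixes A B C D :: "'a::semiring_0 mat"
  assumes "dim_col A = dim_row C" "dim_col B = dim_row D" "dim_row B = dim_row A"
    "dim_col D = dim_col C"
  shows "(A @\<^sub>c B) * (C @\<^sub>r D) = A * C + B * D"
proof (rule eq_matI)
  fix i j assume ij: "i < dim_row (A * C + B * D)" "j < dim_col (A * C + B * D)"
  let ?p = "dim_row C" and ?q = "dim_row D"
  let ?f = "\<lambda>l. (A @\<^sub>c B) $$ (i,l) * (C @\<^sub>r D) $$ (l,j)"
  have "sum ?f {0..<?p + ?q} = sum ?f {0..<?p} + sum ?f {0 + ?p..<?q + ?p}"
    by (simp add: sum.atLeastLessThan_concat add.commute)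
  also have "\<dots> = sum ?f {0..<?p} + (\<Sum>l = 0..<?q. ?f (l + ?p))"
    by (simp only: sum.shift_bounds_nat_ivl)
  also have "\<dots> = (A * C + B * D) $$ (i,j)"
    using assms ij by (simp add: index_append_cols index_append_rows scalar_prod_def)
  finally show "((A @\<^sub>c B) * (C @\<^sub>r D)) $$ (i,j) = (A * C + B * D) $$ (i,j)"
    using assms ij by (simp add: scalar_prod_def)
qed (use assms in simp_all)

lemma one_mat_blocks:
  "1\<^sub>m (p + q) = (1\<^sub>m p @\<^sub>c 0\<^sub>m p q) @\<^sub>r (0\<^sub>m q p @\<^sub>c 1\<^sub>m q)"
  by (intro eq_matI) (auto simp: index_append_cols index_append_rows)

lemma smult_append_cols:
  "dim_row B = dim_row A \<Longrightarrow> x \<cdot>\<^sub>m (A @\<^sub>c B) = x \<cdot>\<^sub>m A @\<^sub>c x \<cdot>\<^sub>m (B :: 'a::semiring_0 mat)"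
  by (intro eq_matI) (auto simp: index_append_cols)

lemma smult_append_rows:
  "dim_col B = dim_col A \<Longrightarrow> x \<cdot>\<^sub>m (A @\<^sub>r B) = x \<cdot>\<^sub>m A @\<^sub>r x \<cdot>\<^sub>m (B :: 'a::semiring_0 mat)"
  by (intro eq_matI) (auto simp: index_append_rows)

lemma mat_add_append_cols:
  fixes A B C D :: "'a::semiring_0 mat"
  assumes "dim_row B = dim_row A" "dim_row C = dim_row A" "dim_row D = dim_row A"
    "dim_col C = dim_col A" "dim_col D = dim_col B"
  shows "(A @\<^sub>c B) + (C @\<^sub>c D) = (A + C) @\<^sub>c (B + D)"
  using assms by (intro eq_matI) (auto simp: index_append_cols)

lemma transpose_smult_mat: "(x \<cdot>\<^sub>m A)\<^sup>T = x \<cdot>\<^sub>m A\<^sup>T"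
  by (intro eq_matI) auto

text \<open>The ring laws of matrices with the dimension conditions as equations between
  \<^const>\<open>dim_row\<close> and \<^const>\<open>dim_col\<close>. In this form the simplifier discharges the
  conditions itself, so noncommutative expansions become automatic.\<close>

lemma mat_mult_assoc_dim:
  fixes A B C :: "'a::semiring_0 mat"
  shows "dim_col A = dim_row B \<Longrightarrow> dim_col B = dim_row C \<Longrightarrow> (A * B) * C = A * (B * C)"
  by (rule assoc_mult_mat[of A "dim_row A" "dim_row B" B "dim_row C" C "dim_col C"]) auto

lemma mat_distrib_dim:
  fixes A B C :: "'a::ring mat"
  shows
    "dim_row B = dim_row A \<Longrightarrow> dim_col A = dim_row C \<Longrightarrow> dim_col B = dim_row C
      \<Longrightarrow> (A + B) * C = A * C + B * C"
    "dim_row B = dim_row A \<Longrightarrow> dim_col A = dim_row C \<Longrightarrow> dim_col B = dim_row C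
      \<Longrightarrow> (A - B) * C = A * C - B * C"
    "dim_row B = dim_col A \<Longrightarrow> dim_row C = dim_col A \<Longrightarrow> dim_col C = dim_col B
      \<Longrightarrow> A * (B + C) = A * B + A * C"
    "dim_row B = dim_col A \<Longrightarrow> dim_row C = dim_col A \<Longrightarrow> dim_col C = dim_col B
      \<Longrightarrow> A * (B - C) = A * B - A * C"
  by (auto intro!: add_mult_distrib_mat[of A "dim_row A" "dim_row C"]
        minus_mult_distrib_mat[of A "dim_row A" "dim_row C"]
        mult_add_distrib_mat[of A "dim_row A" "dim_col A" B "dim_col B"]
        mult_minus_distrib_mat[of A "dim_row A" "dim_col A" B "dim_col B"])

lemma mat_unit_dim:
  fixes A :: "'a::semiring_1 mat"
  shows "dim_row A = p \<Longrightarrow> 1\<^sub>m p * A = A" "dim_col A = q \<Longrightarrow> A * 1\<^sub>m q = A"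
    "dim_row A = p \<Longrightarrow> 0\<^sub>m q p * A = 0\<^sub>m q (dim_col A)"
    "dim_col A = q \<Longrightarrow> A * 0\<^sub>m q p = 0\<^sub>m (dim_row A) p"
  by auto

lemma mat_scale_dim:
  fixes A B :: "'a::comm_ring_1 mat"
  assumes "dim_col A = dim_row B"
  shows "(- A) * B = - (A * B)" "A * (- B) = - (A * B)"
    "(x \<cdot>\<^sub>m A) * B = x \<cdot>\<^sub>m (A * B)" "A * (x \<cdot>\<^sub>m B) = x \<cdot>\<^sub>m (A * B)"
  using assms
  by (auto intro: mult_smult_assoc_mat[of A "dim_row A" "dim_row B"]
        mult_smult_distrib[of A "dim_row A" "dim_row B" B "dim_col B"])

lemmas mat_expand = mat_mult_assoc_dim mat_distrib_dim mat_unit_dim mat_scale_dim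
lemmas block_expand = append_cols_mult_append_rows mult_append_cols append_rows_mult
  smult_append_cols smult_append_rows mat_add_append_cols

section \<open>Inverse of the middle matrix\<close>

text \<open>Back substitution: for a right-hand side \<open>(r\<^sub>1, r\<^sub>2, r\<^sub>3)\<close> the system is solved by
  \<open>x\<^sub>3 = U\<inverse> r\<^sub>3\<close>, then \<open>x\<^sub>1 = D x\<^sub>3 - r\<^sub>1\<close>, then
  \<open>x\<^sub>2 = L\<inverse> (r\<^sub>2 - E x\<^sub>1 - F x\<^sub>3)\<close>. Reading off the coefficients of the \<open>r\<^sub>i\<close> gives the
  second factor.\<close>

lemma bordered_block_mult_inverse:
  fixes L U :: "'a::comm_ring_1 mat"
  assumes L: "L \<in> carrier_mat k k" "L' \<in> carrier_mat k k" "L * L' = 1\<^sub>m k"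
    and U: "U \<in> carrier_mat l l" "U' \<in> carrier_mat l l" "U * U' = 1\<^sub>m l"
    and DEF: "D \<in> carrier_mat p l" "E \<in> carrier_mat k p" "F \<in> carrier_mat k l"
  shows "(((- 1\<^sub>m p) @\<^sub>c 0\<^sub>m p k @\<^sub>c D) @\<^sub>r (E @\<^sub>c L @\<^sub>c F) @\<^sub>r (0\<^sub>m l p @\<^sub>c 0\<^sub>m l k @\<^sub>c U))
       * (((- 1\<^sub>m p) @\<^sub>c 0\<^sub>m p k @\<^sub>c (D * U'))
          @\<^sub>r ((L' * E) @\<^sub>c L' @\<^sub>c (- (L' * (F + E * D) * U')))
          @\<^sub>r (0\<^sub>m l p @\<^sub>c 0\<^sub>m l k @\<^sub>c U')) = 1\<^sub>m (p + (k + l))"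
proof -
  \<comment> \<open>Products associate to the right in the expansion, so \<open>L * L'\<close> is seen only in this form.\<close>
  have L'': "L * (L' * X) = X" if "dim_row X = k" for X
    using that L by (subst mat_mult_assoc_dim[symmetric]) (auto simp: mat_expand)
  have dims: "dim_row L = k" "dim_col L = k" "dim_row L' = k" "dim_col L' = k"
    "dim_row U = l" "dim_col U = l" "dim_row U' = l" "dim_col U' = l"
    "dim_row D = p" "dim_col D = l" "dim_row E = k" "dim_col E = p" "dim_row F = k" "dim_col F = l"
    using assms by auto
  show ?thesis
    by (simp add: block_expand mat_expand dims L'' L(3) U(3), intro eq_matI)
      (auto simp: index_append_cols index_append_rows dims simp del: index_mult_mat(1))
qed

section \<open>Products of reflectors\<close>

lemma transpose_householder [simp]: "(householder v)\<^sup>T = householder v"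
  by (intro eq_matI)
    (auto simp: householder_def outer_prod_def mat_of_col_def mat_of_cols_def scalar_prod_def)

lemma dim_householder [simp]:
  "dim_row (householder v) = dim_vec v" "dim_col (householder v) = dim_vec v"
  by (auto simp: householder_def outer_prod_def)

lemma mat_prod_list_simps [simp]:
  "mat_prod_list n [] = 1\<^sub>m n" "mat_prod_list n (M # Ms) = M * mat_prod_list n Ms"
  by (simp_all add: mat_prod_list_def)

lemma mat_prod_list_carrier [simp]:
  "set Ms \<subseteq> carrier_mat n n \<Longrightarrow> mat_prod_list n Ms \<in> carrier_mat n n"
  by (induction Ms) auto

lemma mat_prod_list_append:
  assumes "set Ms \<subseteq> carrier_mat n n" "set Ns \<subseteq> carrier_mat n n"
  shows "mat_prod_list n (Ms @ Ns) = mat_prod_list n Ms * mat_prod_list n Ns"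
  using assms
proof (induction Ms)
  case Nil
  then show ?case using left_mult_one_mat[OF mat_prod_list_carrier[OF assms(2)]] by simp
next
  case (Cons M Ms)
  then show ?case
    using assoc_mult_mat[of M n n "mat_prod_list n Ms" n "mat_prod_list n Ns" n] by simp
qed

lemma mat_prod_list_rev_symmetric:
  fixes Ms :: "'a::comm_semiring_1 mat list"
  assumes "set Ms \<subseteq> carrier_mat n n" "\<And>M. M \<in> set Ms \<Longrightarrow> M\<^sup>T = M"
  shows "mat_prod_list n (rev Ms) = (mat_prod_list n Ms)\<^sup>T"
  using assms
proof (induction Ms)
  case (Cons M Ms)
  then show ?case
    using transpose_mult[of M n n "mat_prod_list n Ms" n]
    by (auto simp: mat_prod_list_append)
qed simp

lemma mat_of_cols_Cons:
  "v \<in> carrier_vec m \<Longrightarrow> mat_of_cols m (v # vs) = mat_of_col v @\<^sub>c mat_of_cols m vs"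
  by (intro eq_matI) (auto simp: index_append_cols mat_of_col_def mat_of_cols_def nth_Cons')

lemma transpose_mat_of_cols_Cons:
  "v \<in> carrier_vec m \<Longrightarrow> (mat_of_cols m (v # vs))\<^sup>T = mat_of_row v @\<^sub>r (mat_of_cols m vs)\<^sup>T"
  by (intro eq_matI) (auto simp: index_append_rows mat_of_cols_def mat_of_row_def nth_Cons')

lemma reflector_triangle_Cons:
  assumes "v \<in> carrier_vec m" "set vs \<subseteq> carrier_vec m"
  shows "reflector_triangle (v # vs) =
    (1\<^sub>m 1 @\<^sub>c 2 \<cdot>\<^sub>m (mat_of_row v * mat_of_cols m vs))
    @\<^sub>r (0\<^sub>m (length vs) 1 @\<^sub>c reflector_triangle vs)"
  using assms
  by (intro eq_matI)
    (auto simp: index_append_cols index_append_rows reflector_triangle_def nth_Cons' subset_iff)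

lemma dim_reflector_triangle [simp]:
  "dim_row (reflector_triangle vs) = length vs" "dim_col (reflector_triangle vs) = length vs"
  by (simp_all add: reflector_triangle_def)

text \<open>Prepending a reflector \<open>I - 2 v v\<^sup>T\<close> to \<open>I - Y S Y\<^sup>T\<close> adds the terms \<open>- 2 v v\<^sup>T\<close> and
  \<open>2 v (v\<^sup>T Y S) Y\<^sup>T\<close>, so \<open>S\<close> is extended by the first row \<open>[2, - 2 v\<^sup>T Y S]\<close>. This is also
  what inverting the block triangular matrix \<open>[1/2, v\<^sup>T Y; 0, S\<inverse>]\<close> produces, and that matrix is half of
  the extended triangle, since the entries of \<open>v\<^sup>T Y\<close> are the inner products of \<open>v\<close> with the
  later vectors. Both parts of the claim therefore go through the same induction.\<close>

lemma householder_prod_compact: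
  assumes "\<And>v. v \<in> set vs \<Longrightarrow> v \<in> carrier_vec m" "\<And>v. v \<in> set vs \<Longrightarrow> vec_norm2 v = 1"
  shows "\<exists>S \<in> carrier_mat (length vs) (length vs).
    ((1/2) \<cdot>\<^sub>m reflector_triangle vs) * S = 1\<^sub>m (length vs) \<and>
    mat_prod_list m (map householder vs)
      = 1\<^sub>m m - mat_of_cols m vs * S * (mat_of_cols m vs)\<^sup>T"
  using assms
proof (induction vs)
  case Nil
  show ?case
    by (rule bexI[of _ "1\<^sub>m 0"]) (auto simp: scalar_prod_def)
next
  case (Cons v vs)
  let ?k = "length vs" and ?Y = "mat_of_cols m vs" and ?T = "reflector_triangle vs"
  have v: "v \<in> carrier_vec m" "dim_vec v = m" "vec_norm2 v = 1"
    and vs: "set vs \<subseteq> carrier_vec m" using Cons.prems by auto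
  obtain S where S: "S \<in> carrier_mat ?k ?k" "((1/2) \<cdot>\<^sub>m ?T) * S = 1\<^sub>m ?k"
    "mat_prod_list m (map householder vs) = 1\<^sub>m m - ?Y * S * ?Y\<^sup>T"
    using Cons.IH Cons.prems by auto
  have dS: "dim_row S = ?k" "dim_col S = ?k" using S by auto
  have TS: "?T * S = 2 \<cdot>\<^sub>m 1\<^sub>m ?k"
  proof -
    have "(1/2) \<cdot>\<^sub>m (?T * S) = 1\<^sub>m ?k" using S(2) by (simp add: mat_expand dS)
    then have "2 \<cdot>\<^sub>m 1\<^sub>m ?k = 2 \<cdot>\<^sub>m ((1/2) \<cdot>\<^sub>m (?T * S))" by simp
    also have "\<dots> = ?T * S" by (intro eq_matI) (auto simp del: index_mult_mat(1))
    finally show ?thesis by simp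
  qed
  define S' where "S' = (2 \<cdot>\<^sub>m 1\<^sub>m 1 @\<^sub>c - (2 \<cdot>\<^sub>m (mat_of_row v * ?Y * S))) @\<^sub>r (0\<^sub>m ?k 1 @\<^sub>c S)"
  have "S' \<in> carrier_mat (1 + ?k) (1 + ?k)" by (auto simp: S'_def dS)
  moreover have "((1/2) \<cdot>\<^sub>m reflector_triangle (v # vs)) * S' = 1\<^sub>m (1 + ?k)"
    unfolding reflector_triangle_Cons[OF v(1) vs] S'_def one_mat_blocks
    by (simp add: block_expand mat_expand dS TS v, intro eq_matI)
      (auto simp: index_append_cols index_append_rows dS simp del: index_mult_mat(1))
  moreover have "mat_prod_list m (map householder (v # vs))
      = 1\<^sub>m m - mat_of_cols m (v # vs) * S' * (mat_of_cols m (v # vs))\<^sup>T"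
    unfolding transpose_mat_of_cols_Cons[OF v(1)]
    unfolding mat_of_cols_Cons[OF v(1)] S'_def
    by (simp add: S(3) householder_unit v outer_prod_def block_expand mat_expand dS, intro eq_matI)
      (auto simp: dS v simp del: index_mult_mat(1))
  ultimately show ?case by auto
qed

section \<open>Two-sided compact transformation of an additive update\<close>

text \<open>Put \<open>A = B + b c\<close> and \<open>G = I - W U' V\<close>. The product is \<open>A G - Y L' Z A G\<close>, and
  \<open>A G = B - B W U' V + b c G\<close>. The
  block rows of the coefficient matrix, applied to \<open>[c; Z B; V]\<close>, are correspondingly
  \<open>- c G\<close>, \<open>L' Z A G\<close> and \<open>U' V\<close>, and multiplying these by \<open>b\<close>, \<open>Y\<close> and \<open>B W\<close> recovers the
  terms of the product.\<close>

lemma compact_two_sided_update: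
  fixes B :: "'a::comm_ring_1 mat"
  assumes dims: "B \<in> carrier_mat m n" "b \<in> carrier_mat m p" "c \<in> carrier_mat p n"
    "Y \<in> carrier_mat m k" "Z \<in> carrier_mat k m" "W \<in> carrier_mat n l" "V \<in> carrier_mat l n"
    "L' \<in> carrier_mat k k" "U' \<in> carrier_mat l l"
  shows "(1\<^sub>m m - Y * L' * Z) * (B + b * c) * (1\<^sub>m n - W * U' * V) =
    B - (b @\<^sub>c Y @\<^sub>c (B * W))
      * (((- 1\<^sub>m p) @\<^sub>c 0\<^sub>m p k @\<^sub>c (c * W * U'))
         @\<^sub>r ((L' * (Z * b)) @\<^sub>c L' @\<^sub>c (- (L' * (Z * B * W + Z * b * (c * W)) * U')))
         @\<^sub>r (0\<^sub>m l p @\<^sub>c 0\<^sub>m l k @\<^sub>c U'))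
      * (c @\<^sub>r (Z * B) @\<^sub>r V)"
proof -
  have d: "dim_row B = m" "dim_col B = n" "dim_row b = m" "dim_col b = p" "dim_row c = p" "dim_col c = n"
    "dim_row Y = m" "dim_col Y = k" "dim_row Z = k" "dim_col Z = m" "dim_row W = n" "dim_col W = l"
    "dim_row V = l" "dim_col V = n" "dim_row L' = k" "dim_col L' = k" "dim_row U' = l" "dim_col U' = l"
    using dims by auto
  show ?thesis
    by (simp add: block_expand mat_expand d, intro eq_matI)
      (auto simp: d algebra_simps simp del: index_mult_mat(1))
qed

theorem theorem3p1:
  fixes m n k :: nat
    and B A Y W Q P T R Akk M :: "real mat"
    and b c :: "real vec"
    and y w :: "nat \<Rightarrow> real vec"
    and Hl Hr :: "nat \<Rightarrow> real mat"
  assumes "m \<ge> 1" and "n \<ge> 1" and "k \<ge> 1"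
    and "B \<in> carrier_mat m n" and "upper_bidiagonal B"
    and "b \<in> carrier_vec m" and "c \<in> carrier_vec n"
    and "A = B + outer_prod b c"
    and "\<And>i. i \<in> {1..k} \<Longrightarrow> y i \<in> carrier_vec m"
    and "\<And>i. i \<in> {1..k} \<Longrightarrow> vec_norm2 (y i) = 1"
    and "\<And>i. i \<in> {2..k+1} \<Longrightarrow> w i \<in> carrier_vec n"
    and "\<And>i. i \<in> {2..k+1} \<Longrightarrow> vec_norm2 (w i) = 1"
    and "\<And>i. i \<in> {1..k} \<Longrightarrow> Hl i = householder (y i)"
    and "\<And>i. i \<in> {2..k+1} \<Longrightarrow> Hr i = householder (w i)"
    and "Y = mat_of_cols m (map y [1..<k+1])"
    and "W = mat_of_cols n (map w [2..<k+2])"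
    and "Q = mat_prod_list m (map Hl [1..<k+1])"
    and "P = mat_prod_list n (map Hr [2..<k+2])"
    and "T = reflector_triangle (map y [1..<k+1])"
    and "R = reflector_triangle (map w [2..<k+2])"
    and "Akk = mat_prod_list m (map Hl (rev [1..<k+1])) * A * mat_prod_list n (map Hr [2..<k+2])"
    and "M =
          ((- 1\<^sub>m 1)               @\<^sub>c 0\<^sub>m 1 k                        @\<^sub>c (mat_of_row c * W))
       @\<^sub>r ((Y\<^sup>T * mat_of_col b)  @\<^sub>c ((1/2) \<cdot>\<^sub>m T\<^sup>T)  @\<^sub>c (Y\<^sup>T * B * W))
       @\<^sub>r (0\<^sub>m k 1                 @\<^sub>c 0\<^sub>m k k                        @\<^sub>c ((1/2) \<cdot>\<^sub>m R))"
  shows "Akk = Q\<^sup>T * A * P \<and>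
         invertible_mat M \<and>
         Akk = B - (mat_of_col b @\<^sub>c Y @\<^sub>c (B * W)) * mat_inv M
                   * (mat_of_row c @\<^sub>r (Y\<^sup>T * B) @\<^sub>r W\<^sup>T)"
proof -
  note B = assms(4) and b = assms(6) and c = assms(7)
  define ys ws where "ys = map y [1..<k+1]" and "ws = map w [2..<k+2]"
  have Hl: "map Hl [1..<k+1] = map householder ys" and Hr: "map Hr [2..<k+2] = map householder ws"
    using assms(13,14) by (auto simp: ys_def ws_def simp del: upt_Suc)
  have ys: "v \<in> carrier_vec m" "vec_norm2 v = 1" if "v \<in> set ys" for v
    using that assms(9,10) by (auto simp: ys_def)
  have ws: "v \<in> carrier_vec n" "vec_norm2 v = 1" if "v \<in> set ws" for v
    using that assms(11,12) by (auto simp: ws_def)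
  have len: "length ys = k" "length ws = k" by (auto simp: ys_def ws_def)
  have YT: "Y = mat_of_cols m ys" "T = reflector_triangle ys" "Q = mat_prod_list m (map householder ys)"
    using assms(15,17,19) by (simp_all only: Hl ys_def)
  have WR: "W = mat_of_cols n ws" "R = reflector_triangle ws" "P = mat_prod_list n (map householder ws)"
    using assms(16,18,20) by (simp_all only: Hr ws_def)
  obtain S where S: "S \<in> carrier_mat k k" "((1/2) \<cdot>\<^sub>m T) * S = 1\<^sub>m k" "Q = 1\<^sub>m m - Y * S * Y\<^sup>T"
    using householder_prod_compact[of ys m, OF ys] by (auto simp: YT len)
  obtain U' where U': "U' \<in> carrier_mat k k" "((1/2) \<cdot>\<^sub>m R) * U' = 1\<^sub>m k" "P = 1\<^sub>m n - W * U' * W\<^sup>T"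
    using householder_prod_compact[of ws n, OF ws] by (auto simp: WR len)
  have T: "T \<in> carrier_mat k k" and R: "R \<in> carrier_mat k k"
    and Y: "Y \<in> carrier_mat m k" and W: "W \<in> carrier_mat n k"
    using len by (auto simp: YT WR)
  \<comment> \<open>The left factor \<open>Q\<^sup>T\<close> involves \<open>S\<^sup>T\<close>, and a right inverse of \<open>T\<^sup>T/2\<close> is the transpose of a
     left inverse of \<open>T/2\<close>; for square matrices over a field the two kinds coincide.\<close>
  have "S * ((1/2) \<cdot>\<^sub>m T) = 1\<^sub>m k"
    by (rule mat_mult_left_right_inverse[OF _ S(1,2)]) (use T in auto)
  then have "(S * ((1/2) \<cdot>\<^sub>m T))\<^sup>T = 1\<^sub>m k" by simp
  then have TS: "((1/2) \<cdot>\<^sub>m T\<^sup>T) * S\<^sup>T = 1\<^sub>m k"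
    using transpose_mult[OF S(1), of "(1/2) \<cdot>\<^sub>m T" k] T by (simp add: transpose_smult_mat)
  have QT: "Q\<^sup>T = 1\<^sub>m m - Y * S\<^sup>T * Y\<^sup>T"
    using S(1) Y
    by (simp add: S(3) transpose_minus[of _ m m] transpose_mult[of _ m k _ m]
        transpose_mult[of _ k k _ m] mat_mult_assoc_dim)
  let ?b = "mat_of_col b" and ?c = "mat_of_row c"
  have bc: "?b \<in> carrier_mat m 1" "?c \<in> carrier_mat 1 n"
    using b c by auto
  define N where "N = ((- 1\<^sub>m 1) @\<^sub>c 0\<^sub>m 1 k @\<^sub>c (?c * W * U'))
       @\<^sub>r ((S\<^sup>T * (Y\<^sup>T * ?b)) @\<^sub>c S\<^sup>T @\<^sub>c (- (S\<^sup>T * (Y\<^sup>T * B * W + Y\<^sup>T * ?b * (?c * W)) * U')))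
       @\<^sub>r (0\<^sub>m k 1 @\<^sub>c 0\<^sub>m k k @\<^sub>c U')"
  have MN: "M * N = 1\<^sub>m (1 + (k + k))"
    unfolding assms(22) N_def
    by (rule bordered_block_mult_inverse) (use S U' T R TS bc B Y W in auto)
  have cM: "M \<in> carrier_mat (1 + (k + k)) (1 + (k + k))" and cN: "N \<in> carrier_mat (1 + (k + k)) (1 + (k + k))"
    using T R Y W U'(1) S(1) by (auto simp: assms(22) N_def)
  have NM: "N * M = 1\<^sub>m (1 + (k + k))"
    by (rule mat_mult_left_right_inverse[OF cM cN MN])
  have inv: "invertible_mat M"
    using cM cN MN NM by (auto simp: invertible_mat_def inverts_mat_def)
  note I = mat_inv_inverse[OF cM inv]
  have "mat_inv M = mat_inv M * (M * N)" using I(1) MN by simp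
  also have "\<dots> = N" using I cM cN by (simp flip: assoc_mult_mat)
  finally have invM: "mat_inv M = N" .
  have "mat_prod_list m (rev (map householder ys)) = Q\<^sup>T"
    unfolding YT(3) by (rule mat_prod_list_rev_symmetric) (use ys in auto)
  then have "mat_prod_list m (map Hl (rev [1..<k+1])) = Q\<^sup>T"
    by (simp only: Hl[symmetric] rev_map)
  then have Akk: "Akk = Q\<^sup>T * A * P" using assms(21) assms(18) by simp
  also have "\<dots> = B - (?b @\<^sub>c Y @\<^sub>c (B * W)) * N * (?c @\<^sub>r (Y\<^sup>T * B) @\<^sub>r W\<^sup>T)"
    unfolding QT U'(3) assms(8) outer_prod_def N_def
    by (rule compact_two_sided_update[OF B bc Y _ W]) (use Y W S U' in auto)
  finally show ?thesis using Akk inv invM by simp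
qed

end
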